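(* Let $m\le n$ be positive integers with $mn\ge 3$, and put $k=\lfloor n/2\rfloor$ and $t=\lfloor m/2\rfloor$. There is an algorithm which, given $m$ and $n$, computes in time linear in the number $mn$ of grid points a Hamiltonian cycle $T$ of $G(m,n)$ whose value $\mathrm{val}(T)$ satisfies: (i) $\mathrm{val}(T)=\mathrm{OPT}(m,n)$ whenever $n$ is odd, or $m=n$, or $m=2$; (ii) $\mathrm{val}(T)\ge \sqrt{1-\frac{2(k-t)}{(k-t)^2+2t(k-1)+1}}\cdot \mathrm{OPT}(m,n)$ whenever $m$ and $n$ are both even; (iii) $\mathrm{val}(T)\ge \sqrt{1-\frac{2k-1}{k^2+t^2}}\cdot \mathrm{OPT}(m,n)$ whenever $n$ is even and $m$ is odd.
   Context: For positive integers $m,n$, let $V(m,n)=\{(x,y)\in\mathbb{Z}^2 : 1\le x\le n,\ 1\le y\le m\}$ (the regular rectangular grid with $m$ rows and $n$ columns), and let $G(m,n)$ be the complete graph on $V(m,n)$, where each edge is weighted by the Euclidean distance between its endpoints. A tour is a Hamiltonian cycle of $G(m,n)$. The value $\mathrm{val}(T)$ of a tour $T$ is the length of its shortest edge. The maximum scatter TSP on the grid, $\textsc{MSTSP}(m,n)$, asks for a tour maximizing this value; $\mathrm{OPT}(m,n)$ denotes the maximum of $\mathrm{val}(T)$ over all tours $T$. *)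

theory Defs
  imports "HOL-Analysis.Product_Vector"
begin

section \<open>The maximum scatter TSP on the grid\<close>

type_synonym point = "int \<times> int"

definition grid :: "nat \<Rightarrow> nat \<Rightarrow> point set" where
  "grid m n = {(x, y). 1 \<le> x \<and> x \<le> int n \<and> 1 \<le> y \<and> y \<le> int m}"

definition grid_adj :: "nat \<Rightarrow> nat \<Rightarrow> point \<Rightarrow> point \<Rightarrow> bool" where
  "grid_adj m n u v \<longleftrightarrow> u \<in> grid m n \<and> v \<in> grid m n \<and> u \<noteq> v"

text \<open>The library distance on \<open>real \<times> real\<close> is the Euclidean one.\<close>

definition edge_length :: "point \<Rightarrow> point \<Rightarrow> real" where
  "edge_length u v =
     dist (real_of_int (fst u), real_of_int (snd u)) (real_of_int (fst v), real_of_int (snd v))"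

text \<open>A cycle is given by the list of its vertices in cyclic order; its edges join consecutive
  vertices, and the last vertex to the first.\<close>

definition cycle_edges :: "'a list \<Rightarrow> ('a \<times> 'a) set" where
  "cycle_edges vs = set (zip vs (rotate1 vs))"

definition hamiltonian_cycle :: "'a set \<Rightarrow> ('a \<Rightarrow> 'a \<Rightarrow> bool) \<Rightarrow> 'a list \<Rightarrow> bool" where
  "hamiltonian_cycle V adj vs \<longleftrightarrow>
     3 \<le> length vs \<and> distinct vs \<and> set vs = V \<and> (\<forall>(u, v) \<in> cycle_edges vs. adj u v)"

definition tour :: "nat \<Rightarrow> nat \<Rightarrow> point list \<Rightarrow> bool" where
  "tour m n T \<longleftrightarrow> hamiltonian_cycle (grid m n) (grid_adj m n) T"

definition val :: "point list \<Rightarrow> real" where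
  "val T = Min ((\<lambda>(u, v). edge_length u v) ` cycle_edges T)"

definition OPT :: "nat \<Rightarrow> nat \<Rightarrow> real" where
  "OPT m n = Max (val ` {T. tour m n T})"

section \<open>Random access machine programs\<close>

text \<open>Algorithms are programs of a uniform-cost random access machine with integer memory cells,
  indirect addressing and a write-only output tape. The arithmetic is restricted to addition and
  subtraction, so that unit cost is not abused to create huge numbers by repeated squaring.\<close>

datatype aexp = Const int | Mem aexp | Add aexp aexp | Sub aexp aexp

datatype bexp = Less aexp aexp | Neg bexp | Conj bexp bexp

datatype com =
    Skip
  | Store aexp aexp
  | Write aexp
  | Seq com com
  | Cond bexp com com
  | While bexp com

type_synonym memory = "int \<Rightarrow> int"

fun aval :: "aexp \<Rightarrow> memory \<Rightarrow> int" where
  "aval (Const i) s = i"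
| "aval (Mem a) s = s (aval a s)"
| "aval (Add a b) s = aval a s + aval b s"
| "aval (Sub a b) s = aval a s - aval b s"

fun bval :: "bexp \<Rightarrow> memory \<Rightarrow> bool" where
  "bval (Less a b) s \<longleftrightarrow> aval a s < aval b s"
| "bval (Neg b) s \<longleftrightarrow> \<not> bval b s"
| "bval (Conj b c) s \<longleftrightarrow> bval b s \<and> bval c s"

fun acost :: "aexp \<Rightarrow> nat" where
  "acost (Const i) = 1"
| "acost (Mem a) = 1 + acost a"
| "acost (Add a b) = 1 + acost a + acost b"
| "acost (Sub a b) = 1 + acost a + acost b"

fun bcost :: "bexp \<Rightarrow> nat" where
  "bcost (Less a b) = 1 + acost a + acost b"
| "bcost (Neg b) = 1 + bcost b"
| "bcost (Conj b c) = 1 + bcost b + bcost c"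

text \<open>\<open>exec p (s, out) t (s', out')\<close>: started with memory \<open>s\<close> and output \<open>out\<close>, the
  program \<open>p\<close> halts after exactly \<open>t\<close> steps with memory \<open>s'\<close> and output \<open>out'\<close>.\<close>

inductive exec :: "com \<Rightarrow> memory \<times> int list \<Rightarrow> nat \<Rightarrow> memory \<times> int list \<Rightarrow> bool" where
  exec_Skip: "exec Skip (s, out) 1 (s, out)"
| exec_Store: "exec (Store a e) (s, out) (1 + acost a + acost e) (s(aval a s := aval e s), out)"
| exec_Write: "exec (Write e) (s, out) (1 + acost e) (s, out @ [aval e s])"
| exec_Seq: "exec p \<sigma> t \<sigma>' \<Longrightarrow> exec q \<sigma>' u \<sigma>'' \<Longrightarrow> exec (Seq p q) \<sigma> (1 + t + u) \<sigma>''"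
| exec_CondT: "bval b (fst \<sigma>) \<Longrightarrow> exec p \<sigma> t \<sigma>' \<Longrightarrow> exec (Cond b p q) \<sigma> (1 + bcost b + t) \<sigma>'"
| exec_CondF: "\<not> bval b (fst \<sigma>) \<Longrightarrow> exec q \<sigma> t \<sigma>' \<Longrightarrow> exec (Cond b p q) \<sigma> (1 + bcost b + t) \<sigma>'"
| exec_WhileF: "\<not> bval b (fst \<sigma>) \<Longrightarrow> exec (While b p) \<sigma> (1 + bcost b) \<sigma>"
| exec_WhileT: "bval b (fst \<sigma>) \<Longrightarrow> exec p \<sigma> t \<sigma>' \<Longrightarrow> exec (While b p) \<sigma>' u \<sigma>'' \<Longrightarrow>
    exec (While b p) \<sigma> (1 + bcost b + t + u) \<sigma>''"

inductive_cases exec_SkipE: "exec Skip \<sigma> t \<sigma>'"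
inductive_cases exec_StoreE: "exec (Store a e) \<sigma> t \<sigma>'"
inductive_cases exec_WriteE: "exec (Write e) \<sigma> t \<sigma>'"
inductive_cases exec_SeqE: "exec (Seq p q) \<sigma> t \<sigma>'"
inductive_cases exec_CondE: "exec (Cond b p q) \<sigma> t \<sigma>'"
inductive_cases exec_WhileE: "exec (While b p) \<sigma> t \<sigma>'"

lemma exec_deterministic:
  "exec p \<sigma> t \<sigma>' \<Longrightarrow> exec p \<sigma> u \<sigma>'' \<Longrightarrow> u = t \<and> \<sigma>'' = \<sigma>'"
proof (induction arbitrary: u \<sigma>'' rule: exec.induct)
  case exec_Skip
  then show ?case by (auto elim: exec_SkipE)
next
  case exec_Store
  then show ?case by (auto elim: exec_StoreE)
next
  case exec_Write
  then show ?case by (auto elim: exec_WriteE)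
next
  case (exec_Seq p \<sigma> t \<sigma>' q t' \<sigma>1)
  from exec_Seq.prems show ?case
  proof (rule exec_SeqE)
    fix v w \<tau> assume "u = Suc (v + w)" "exec p \<sigma> v \<tau>" "exec q \<tau> w \<sigma>''"
    with exec_Seq.IH(1)[of v \<tau>] exec_Seq.IH(2)[of w \<sigma>''] show ?thesis by simp
  qed
next
  case (exec_CondT b \<sigma> p t \<sigma>' q)
  from exec_CondT.prems show ?case
    by (rule exec_CondE) (auto simp: exec_CondT.hyps dest: exec_CondT.IH)
next
  case (exec_CondF b \<sigma> q t \<sigma>' p)
  from exec_CondF.prems show ?case
    by (rule exec_CondE) (auto simp: exec_CondF.hyps dest: exec_CondF.IH)
next
  case (exec_WhileF b \<sigma> p)
  from exec_WhileF.prems show ?case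
    by (rule exec_WhileE) (auto simp: exec_WhileF.hyps)
next
  case (exec_WhileT b \<sigma> p t \<sigma>' t' \<sigma>1)
  from exec_WhileT.prems show ?case
  proof (rule exec_WhileE)
    assume "\<not> bval b (fst \<sigma>)"
    with exec_WhileT.hyps show ?thesis by simp
  next
    fix v \<tau> w
    assume "u = Suc (bcost b + v + w)" "exec p \<sigma> v \<tau>" "exec (While b p) \<tau> w \<sigma>''"
    with exec_WhileT.IH(1)[of v \<tau>] exec_WhileT.IH(2)[of w \<sigma>''] show ?thesis by simp
  qed
qed

text \<open>The input occupies the memory cells \<open>0, 1, \<dots>\<close>; all other cells are initially \<open>0\<close>.\<close>

definition input_memory :: "int list \<Rightarrow> memory" where
  "input_memory xs = (\<lambda>a. if 0 \<le> a \<and> a < int (length xs) then xs ! nat a else 0)"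

definition computes_within :: "com \<Rightarrow> int list \<Rightarrow> int list \<Rightarrow> nat \<Rightarrow> bool" where
  "computes_within p xs ys b \<longleftrightarrow>
     (\<exists>t s'. t \<le> b \<and> exec p (input_memory xs, []) t (s', ys))"

text \<open>A tour is output as the coordinate sequence \<open>x\<^sub>1, y\<^sub>1, x\<^sub>2, y\<^sub>2, \<dots>\<close> of its vertices.\<close>

definition encode_tour :: "point list \<Rightarrow> int list" where
  "encode_tour T = concat (map (\<lambda>(x, y). [x, y]) T)"

end

theory Submission
  imports Defs
begin

text \<open>Let \<open>k = \<lfloor>n/2\<rfloor>\<close> and \<open>t = \<lfloor>m/2\<rfloor>\<close>. A vertex near the centre of the grid bounds
  \<open>OPT\<^sup>2\<close> from above: by \<open>k\<^sup>2 + t\<^sup>2\<close> in general, and by \<open>k\<^sup>2 + (t - 1)\<^sup>2\<close> if \<open>m\<close> and \<open>n\<close> are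
  even, because then the vertex \<open>(k, t)\<close> has only one partner at distance \<open>\<surd>(k\<^sup>2 + t\<^sup>2)\<close> but
  needs two. Conversely, arrange the columns cyclically such that consecutive ones are at least \<open>k\<close>
  (\<open>n\<close> odd) or \<open>k - 1\<close> (\<open>n\<close> even) apart, and go round this cycle \<open>m\<close> times, alternating in each
  round between two rows at distance at least \<open>t\<close>. The change of rows between two rounds takes
  place at a wide step of the column cycle, of width \<open>k + 1\<close> or \<open>2k - 1\<close>, which makes up for the
  smaller distance of the rows. So all squared edge lengths are at least \<open>k\<^sup>2 + t\<^sup>2\<close> or
  \<open>(k - 1)\<^sup>2 + t\<^sup>2\<close>, respectively.\<close>

section \<open>Edges of cycles\<close>

lemma cycle_edges_nth:
  "cycle_edges vs = (\<lambda>p. (vs ! p, vs ! (Suc p mod length vs))) ` {..<length vs}"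
  unfolding cycle_edges_def set_zip by (auto simp: nth_rotate1 image_iff)

lemma finite_grid: "finite (grid m n)"
  and card_grid: "card (grid m n) = m * n"
proof -
  have "grid m n = {1..int n} \<times> {1..int m}"
    by (auto simp: grid_def)
  then show "finite (grid m n)" "card (grid m n) = m * n"
    by (auto simp: card_cartesian_product)
qed

lemma edge_length_eq:
  "edge_length u v = sqrt (real_of_int ((fst u - fst v)\<^sup>2 + (snd u - snd v)\<^sup>2))"
  by (simp add: edge_length_def dist_prod_def dist_real_def)

lemma val_le_edge_length:
  assumes "p < length T"
  shows "val T \<le> edge_length (T ! p) (T ! (Suc p mod length T))"
  unfolding val_def using assms by (intro Min_le) (auto simp: cycle_edges_nth)

lemma le_valI:
  assumes "T \<noteq> []"
    and "\<And>p. p < length T \<Longrightarrow> B \<le> edge_length (T ! p) (T ! (Suc p mod length T))"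
  shows "B \<le> val T"
  unfolding val_def using assms by (subst Min_ge_iff) (auto simp: cycle_edges_nth)

lemma tour_length: "tour m n T \<Longrightarrow> length T = m * n"
  using card_grid[of m n] unfolding tour_def hamiltonian_cycle_def
  by (metis distinct_card)

text \<open>The predecessor and the successor of \<open>v\<close> differ because a tour has at least
  3 vertices. Their positions \<open>p\<close> and \<open>q\<close> are kept so that walks along the
  tour can be compared later.\<close>

lemma tour_neighbours:
  assumes T: "tour m n T" and v: "v \<in> grid m n"
  obtains p q where "p < length T" "q < length T" "T ! (Suc p mod length T) = v"
    "q = Suc (Suc p) mod length T" "T ! p \<in> grid m n" "T ! q \<in> grid m n" "T ! p \<noteq> T ! q"
    "val T \<le> edge_length v (T ! p)" "val T \<le> edge_length v (T ! q)"
proof -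
  let ?N = "length T"
  have T3: "3 \<le> ?N" "distinct T" "set T = grid m n"
    using T by (auto simp: tour_def hamiltonian_cycle_def)
  obtain r where r: "r < ?N" "T ! r = v"
    using v T3 by (metis in_set_conv_nth)
  define p where "p = (r + (?N - 1)) mod ?N"
  have rp: "Suc p mod ?N = r"
  proof -
    have "Suc (r + (?N - 1)) = r + ?N" using T3 by simp
    then have "Suc p mod ?N = (r + ?N) mod ?N" by (simp only: p_def mod_Suc_eq)
    then show ?thesis using r by simp
  qed
  define q where "q = Suc r mod ?N"
  have q: "q = Suc (Suc p) mod ?N"
    by (metis rp mod_Suc_eq q_def)
  have lt: "p < ?N" "q < ?N"
    using T3 by (auto simp: p_def q_def intro!: mod_less_divisor)
  have "p \<noteq> q"
    using q lt T3 by (auto simp: mod_Suc split: if_splits)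
  then have "T ! p \<noteq> T ! q"
    using lt T3 by (simp add: nth_eq_iff_index_eq)
  moreover have "val T \<le> edge_length v (T ! p)"
    using val_le_edge_length[OF lt(1)] rp r by (simp add: edge_length_def dist_commute)
  moreover have "val T \<le> edge_length v (T ! q)"
    using val_le_edge_length[OF r(1)] r by (simp add: q_def)
  ultimately show thesis
    using that[of p q] lt q rp r T3(3) by (metis nth_mem)
qed

lemma finite_tours: "finite {T. tour m n T}"
proof (rule finite_subset)
  show "{T. tour m n T} \<subseteq> {T. set T \<subseteq> grid m n \<and> length T = m * n}"
    by (auto simp: tour_length) (auto simp: tour_def hamiltonian_cycle_def)
  show "finite {T. set T \<subseteq> grid m n \<and> length T = m * n}"
    by (rule finite_lists_length_eq[OF finite_grid])
qed

lemma val_le_OPT: "tour m n T \<Longrightarrow> val T \<le> OPT m n"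
  unfolding OPT_def using finite_tours by (intro Max_ge) auto

text \<open>One tour has to be supplied, since \<open>Max\<close> of the empty set has no useful
  value.\<close>

lemma OPT_leI:
  assumes "tour m n T" and "\<And>T. tour m n T \<Longrightarrow> val T \<le> B"
  shows "OPT m n \<le> B"
  unfolding OPT_def using assms finite_tours by (subst Max_le_iff) auto

section \<open>Upper bounds\<close>

lemma abs_le_imp_square_le: "\<bar>a\<bar> \<le> b \<Longrightarrow> a\<^sup>2 \<le> (b::int)\<^sup>2"
  by (metis abs_ge_zero power2_abs power_mono)

text \<open>No grid point is more than \<open>a\<close> columns or \<open>b\<close> rows away from
  \<open>(x, y)\<close>, which limits the tour edges at that vertex.\<close>

lemma val_le_far_vertex:
  assumes T: "tour m n T" and v: "(x, y) \<in> grid m n"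
    and far: "x - 1 \<le> a" "int n - x \<le> a" "y - 1 \<le> b" "int m - y \<le> b"
  shows "val T \<le> sqrt (real_of_int (a\<^sup>2 + b\<^sup>2))"
proof -
  obtain u where u: "u \<in> grid m n" "val T \<le> edge_length (x, y) u"
    using tour_neighbours[OF T v] by metis
  have "\<bar>x - fst u\<bar> \<le> a" "\<bar>y - snd u\<bar> \<le> b"
    using u far by (auto simp: grid_def)
  then have "(x - fst u)\<^sup>2 + (y - snd u)\<^sup>2 \<le> a\<^sup>2 + b\<^sup>2"
    by (intro add_mono abs_le_imp_square_le)
  then have "edge_length (x, y) u \<le> sqrt (real_of_int (a\<^sup>2 + b\<^sup>2))"
    unfolding edge_length_eq by (simp only: real_sqrt_le_iff of_int_le_iff fst_conv snd_conv)
  with u show ?thesis by linarith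
qed

text \<open>Of two different tour neighbours of \<open>(k, t)\<close>, one is not the corner
  \<open>(2 * k, 2 * t)\<close>, so it falls short of the largest offset by a row or by a column.
  Losing the row leaves the larger bound because \<open>t \<le> k\<close>.\<close>

lemma val_le_even_even:
  fixes k t :: int
  assumes T: "tour m n T" and n: "int n = 2 * k" and m: "int m = 2 * t" and tk: "1 \<le> t" "t \<le> k"
  shows "val T \<le> sqrt (real_of_int (k\<^sup>2 + (t - 1)\<^sup>2))"
proof -
  have "(k, t) \<in> grid m n"
    using assms by (auto simp: grid_def)
  then obtain u where u: "u \<in> grid m n" "u \<noteq> (2 * k, 2 * t)" "val T \<le> edge_length (k, t) u"
    using tour_neighbours[OF T, of "(k, t)"] by metis
  have "(k - fst u)\<^sup>2 + (t - snd u)\<^sup>2 \<le> k\<^sup>2 + (t - 1)\<^sup>2"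
  proof (cases "fst u = 2 * k")
    case True
    then have "\<bar>k - fst u\<bar> \<le> k" "\<bar>t - snd u\<bar> \<le> t - 1"
      using u tk n m by (auto simp: grid_def abs_le_iff prod_eq_iff)
    then show ?thesis
      by (intro add_mono abs_le_imp_square_le)
  next
    case False
    then have "\<bar>k - fst u\<bar> \<le> k - 1" "\<bar>t - snd u\<bar> \<le> t"
      using u tk n m by (auto simp: grid_def)
    then have "(k - fst u)\<^sup>2 + (t - snd u)\<^sup>2 \<le> (k - 1)\<^sup>2 + t\<^sup>2"
      by (intro add_mono abs_le_imp_square_le)
    also have "\<dots> \<le> k\<^sup>2 + (t - 1)\<^sup>2"
      using tk by (simp add: power2_eq_square algebra_simps)
    finally show ?thesis .
  qed
  then have "edge_length (k, t) u \<le> sqrt (real_of_int (k\<^sup>2 + (t - 1)\<^sup>2))"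
    unfolding edge_length_eq by (simp only: real_sqrt_le_iff of_int_le_iff fst_conv snd_conv)
  with u show ?thesis by linarith
qed

text \<open>On a longer tour both \<open>(k, 1)\<close> and \<open>(k, 2)\<close> would have \<open>(2k, 1)\<close> and \<open>(2k, 2)\<close> as their
  neighbours, which closes a cycle of length 4.\<close>

lemma val_le_two_rows:
  fixes k :: int
  assumes T: "tour 2 n T" and n: "int n = 2 * k" and k: "2 \<le> k"
  shows "val T \<le> sqrt (real_of_int ((k - 1)\<^sup>2 + 1))"
proof (rule ccontr)
  let ?N = "length T"
  assume "\<not> ?thesis"
  then have big: "sqrt (real_of_int ((k - 1)\<^sup>2 + 1)) < val T" by simp
  have near: "u = (2 * k, 1) \<or> u = (2 * k, 2)"
    if u: "u \<in> grid 2 n" "val T \<le> edge_length (k, y) u" and y: "y \<in> {1, 2}" for u y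
  proof -
    have "sqrt (real_of_int ((k - 1)\<^sup>2 + 1)) < edge_length (k, y) u"
      using big u by linarith
    then have less: "(k - 1)\<^sup>2 + 1 < (k - fst u)\<^sup>2 + (y - snd u)\<^sup>2"
      unfolding edge_length_eq by (simp only: real_sqrt_less_iff of_int_less_iff fst_conv snd_conv)
    have "fst u = 2 * k"
    proof (rule ccontr)
      assume "fst u \<noteq> 2 * k"
      then have "\<bar>k - fst u\<bar> \<le> k - 1" "\<bar>y - snd u\<bar> \<le> 1"
        using u y k n by (auto simp: grid_def)
      then have "(k - fst u)\<^sup>2 + (y - snd u)\<^sup>2 \<le> (k - 1)\<^sup>2 + 1\<^sup>2"
        by (intro add_mono abs_le_imp_square_le)
      with less show False by simp
    qed
    moreover have "snd u = 1 \<or> snd u = 2"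
      using u by (auto simp: grid_def)
    ultimately show ?thesis
      by (auto simp: prod_eq_iff)
  qed
  have N: "?N = 2 * n" "distinct T"
    using tour_length[OF T] T by (auto simp: tour_def hamiltonian_cycle_def)
  have "(k, 1) \<in> grid 2 n" "(k, 2) \<in> grid 2 n"
    using n k by (auto simp: grid_def)
  note nb = tour_neighbours[OF T this(1)] tour_neighbours[OF T this(2)]
  obtain p q where p: "p < ?N" "q < ?N" "T ! (Suc p mod ?N) = (k, 1)"
      "q = Suc (Suc p) mod ?N" "T ! p \<in> grid 2 n" "T ! q \<in> grid 2 n" "T ! p \<noteq> T ! q"
      "val T \<le> edge_length (k, 1) (T ! p)" "val T \<le> edge_length (k, 1) (T ! q)"
    using nb(1) by blast
  obtain p' q' where p': "p' < ?N" "q' < ?N" "T ! (Suc p' mod ?N) = (k, 2)"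
      "q' = Suc (Suc p') mod ?N" "T ! p' \<in> grid 2 n" "T ! q' \<in> grid 2 n" "T ! p' \<noteq> T ! q'"
      "val T \<le> edge_length (k, 2) (T ! p')" "val T \<le> edge_length (k, 2) (T ! q')"
    using nb(2) by blast
  \<comment> \<open>All four neighbours lie in \<open>{(2 * k, 1), (2 * k, 2)}\<close>. As the two
    predecessors differ, the predecessor of either vertex is the successor of the other.\<close>
  have "p \<noteq> p'"
    using p(3) p'(3) by auto
  then have "T ! p \<noteq> T ! p'"
    using p(1) p'(1) N by (simp add: nth_eq_iff_index_eq)
  moreover note near[OF p(5,8)] near[OF p(6,9)] near[OF p'(5,8)] near[OF p'(6,9)] p(7) p'(7)
  ultimately have "T ! p = T ! q'" "T ! q = T ! p'"
    by auto
  then have "p = q'" "q = p'"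
    using p(1,2) p'(1,2) N by (simp_all add: nth_eq_iff_index_eq)
  \<comment> \<open>Four steps along the tour lead back to \<open>p\<close>, although it has
    \<open>2 * n \<ge> 8\<close> vertices.\<close>
  then have "p = Suc (Suc (Suc (Suc p))) mod ?N"
    using p(4) p'(4) by (metis mod_Suc_eq)
  moreover have "?N > 4"
    using N n k by simp
  ultimately show False
    using p(1) by (auto simp: mod_Suc split: if_splits)
qed

section \<open>The tour\<close>

text \<open>The sequence \<open>0, e, 1, e + 1, 2, \<dots>\<close> with \<open>e = \<lceil>n/2\<rceil>\<close>: consecutive elements differ by
  \<open>e\<close> or \<open>e - 1\<close>.\<close>

definition zigzag :: "nat \<Rightarrow> nat \<Rightarrow> nat" where
  "zigzag n i = i div 2 + (if even i then 0 else n - n div 2)"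

lemma zigzag_less: "i < n \<Longrightarrow> zigzag n i < n"
  unfolding zigzag_def by (cases "even i"; cases "even n") (auto elim!: evenE oddE)

text \<open>Even positions take the values below \<open>n - n div 2\<close>, odd positions the
  values from there on.\<close>

lemma zigzag_inj: "i < n \<Longrightarrow> j < n \<Longrightarrow> zigzag n i = zigzag n j \<Longrightarrow> i = j"
  unfolding zigzag_def by (cases "even i"; cases "even j"; cases "even n") (auto elim!: evenE oddE)

text \<open>The next value depends on the current value only, so a program can update it in a single
  register.\<close>

lemma zigzag_Suc:
  assumes "Suc i < n"
  shows "zigzag n (Suc i) =
    (if zigzag n i < n div 2 then zigzag n i + (n - n div 2) else zigzag n i + 1 - (n - n div 2))"
  using assms unfolding zigzag_def by (cases "even i"; cases "even n") (auto elim!: evenE oddE)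

text \<open>The starting point is chosen so that a round ends with a wide step: from
  \<open>n - 1\<close> to \<open>0\<close> for even \<open>n\<close>, and, after the shift by one,
  from \<open>0\<close> to \<open>n div 2 + 1\<close> for odd \<open>n \<ge> 3\<close>.\<close>

definition column :: "nat \<Rightarrow> nat \<Rightarrow> nat" where
  "column n i = (if even n then zigzag n i else zigzag n (Suc i mod n))"

text \<open>For fixed \<open>i\<close> this is a permutation of the rows, so each column is filled
  once in \<open>m\<close> rounds. Ordering the rounds by \<open>zigzag\<close> keeps consecutive
  rounds far apart at even positions, which matters at the end of a round when \<open>n\<close> is
  odd.\<close>

definition row :: "nat \<Rightarrow> nat \<Rightarrow> nat \<Rightarrow> nat" where
  "row m i j = (if even i then zigzag m j else (zigzag m j + m div 2) mod m)"

text \<open>The tour runs \<open>m\<close> times through all columns; round \<open>j\<close> alternates between two rows that are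
  about \<open>m/2\<close> apart.\<close>

definition tour_point :: "nat \<Rightarrow> nat \<Rightarrow> nat \<Rightarrow> point" where
  "tour_point m n p =
     (int (column n (p mod n)) + 1, int (row m (p mod n) (p div n)) + 1)"

definition scatter_tour :: "nat \<Rightarrow> nat \<Rightarrow> point list" where
  "scatter_tour m n = map (tour_point m n) [0..<m * n]"

section \<open>The tour is a Hamiltonian cycle\<close>

lemma column_less: "i < n \<Longrightarrow> column n i < n"
  unfolding column_def by (auto intro!: zigzag_less mod_less_divisor)

lemma column_inj: "i < n \<Longrightarrow> j < n \<Longrightarrow> column n i = column n j \<Longrightarrow> i = j"
  unfolding column_def
  by (auto split: if_splits dest!: zigzag_inj[rotated 2] simp: mod_Suc)

lemma row_less: "j < m \<Longrightarrow> row m i j < m"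
  unfolding row_def by (auto intro!: zigzag_less mod_less_divisor)

text \<open>The cyclic shift without \<open>mod\<close>: it moves up by \<open>m div 2\<close> or
  down by \<open>m - m div 2\<close>, in both cases by at least \<open>m div 2\<close>. The program
  computes it in this form.\<close>

lemma row_odd:
  assumes "j < m" "odd i"
  shows "row m i j = (if zigzag m j < m - m div 2 then zigzag m j + m div 2
    else zigzag m j - (m - m div 2))"
  using zigzag_less[OF assms(1)] assms(2) by (auto simp: row_def mod_if)

lemma row_inj:
  assumes "j < m" "j' < m" "row m i j = row m i j'"
  shows "j = j'"
proof -
  have "zigzag m j = zigzag m j'"
  proof (cases "even i")
    case True
    then show ?thesis using assms by (simp add: row_def)
  next
    case False
    then show ?thesis
      using assms zigzag_less[of j m] zigzag_less[of j' m] by (auto simp: row_odd split: if_splits)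
  qed
  then show ?thesis using assms zigzag_inj by blast
qed

text \<open>The column of a point determines \<open>p mod n\<close>, and then its row determines
  \<open>p div n\<close>. An injection from \<open>m * n\<close> positions into the grid is onto by
  counting.\<close>

lemma scatter_tour_tour:
  assumes "3 \<le> m * n"
  shows "tour m n (scatter_tour m n)"
proof -
  have n: "0 < n" using assms by (cases n) auto
  have div: "p div n < m" if "p < m * n" for p
    using that by (simp add: less_mult_imp_div_less)
  have inj: "inj_on (tour_point m n) {..<m * n}"
  proof (rule inj_onI)
    fix p q assume pq: "p \<in> {..<m * n}" "q \<in> {..<m * n}" "tour_point m n p = tour_point m n q"
    then have "p mod n = q mod n"
      using n column_inj[of "p mod n" n "q mod n"] by (simp add: tour_point_def)
    moreover from this have "p div n = q div n"
      using pq div row_inj[of "p div n" m "q div n" "p mod n"] by (simp add: tour_point_def)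
    ultimately show "p = q"
      by (metis div_mult_mod_eq)
  qed
  have "tour_point m n ` {..<m * n} \<subseteq> grid m n"
  proof clarsimp
    fix p assume "p < m * n"
    then show "tour_point m n p \<in> grid m n"
      using n column_less[of "p mod n" n] row_less[OF div, of p "p mod n"]
      by (auto simp: tour_point_def grid_def)
  qed
  then have img: "tour_point m n ` {..<m * n} = grid m n"
    using inj by (intro card_subset_eq) (auto simp: finite_grid card_grid card_image)
  let ?T = "scatter_tour m n"
  have len: "length ?T = m * n" and dist: "distinct ?T" and set: "set ?T = grid m n"
    using inj img by (auto simp: scatter_tour_def distinct_map atLeast0LessThan)
  have "grid_adj m n u v" if "(u, v) \<in> cycle_edges ?T" for u v
  proof -
    obtain p where p: "p < m * n" "u = ?T ! p" "v = ?T ! (Suc p mod (m * n))"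
      using \<open>(u, v) \<in> cycle_edges ?T\<close> by (auto simp: cycle_edges_nth len)
    have "Suc p mod (m * n) < m * n" "Suc p mod (m * n) \<noteq> p"
      using p(1) assms n by (auto simp: mod_Suc intro: Nat.gr0I)
    then have "u \<in> set ?T" "v \<in> set ?T" "u \<noteq> v"
      using p dist len by (simp_all add: nth_eq_iff_index_eq)
    then show ?thesis by (simp add: grid_adj_def set)
  qed
  then show ?thesis
    unfolding tour_def hamiltonian_cycle_def using assms len dist set by auto
qed

section \<open>Edge lengths of the tour\<close>

definition guarantee :: "nat \<Rightarrow> nat \<Rightarrow> int" where
  "guarantee m n = (if odd n then (int (n div 2))\<^sup>2 + (int (m div 2))\<^sup>2
     else (int (n div 2) - 1)\<^sup>2 + (int (m div 2))\<^sup>2)"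

lemma square_mono_abs: "0 \<le> a \<Longrightarrow> a \<le> \<bar>b\<bar> \<Longrightarrow> a\<^sup>2 \<le> (b::int)\<^sup>2"
  by (metis power2_abs power_mono)

lemma zigzag_gap:
  assumes "Suc i < n"
  shows "int (n - n div 2) - 1 \<le> \<bar>int (zigzag n i) - int (zigzag n (Suc i))\<bar>"
  using assms unfolding zigzag_def by (cases "even i"; cases "even n") (auto elim!: evenE oddE)

text \<open>Only the closing step is new: it runs from \<open>n div 2\<close> to \<open>0\<close>
  for odd \<open>n\<close> and from \<open>n - 1\<close> to \<open>0\<close> for even
  \<open>n\<close>.\<close>

lemma zigzag_gap_cyclic:
  assumes "i < n"
  shows "int (n div 2) - 1 \<le> \<bar>int (zigzag n i) - int (zigzag n (Suc i mod n))\<bar>"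
    and "odd n \<Longrightarrow> int (n div 2) \<le> \<bar>int (zigzag n i) - int (zigzag n (Suc i mod n))\<bar>"
proof -
  have last: "int (n div 2) \<le> \<bar>int (zigzag n i) - int (zigzag n 0)\<bar>" if "odd n" "Suc i = n"
    using that unfolding zigzag_def by auto
  have "Suc i < n \<or> Suc i = n" using assms by auto
  then show "odd n \<Longrightarrow> int (n div 2) \<le> \<bar>int (zigzag n i) - int (zigzag n (Suc i mod n))\<bar>"
    using last zigzag_gap[of i n] by (auto elim!: oddE)
  have "int (n div 2) - 1 \<le> \<bar>int (zigzag n i) - int (zigzag n 0)\<bar>" if "even n" "Suc i = n"
    using that unfolding zigzag_def by auto
  with \<open>Suc i < n \<or> Suc i = n\<close> show
    "int (n div 2) - 1 \<le> \<bar>int (zigzag n i) - int (zigzag n (Suc i mod n))\<bar>"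
    using last zigzag_gap[of i n] by (cases "even n") auto
qed

lemma row_gap:
  assumes "j < m"
  shows "int (m div 2) \<le> \<bar>int (row m i j) - int (row m (Suc i) j)\<bar>"
proof -
  have "int (m div 2) \<le> \<bar>int (row m i' j) - int (row m i'' j)\<bar>" if "even i'" "odd i''" for i' i''
    using row_odd[OF assms that(2)] that zigzag_less[OF assms] by (auto simp: row_def[of m i'])
  from this[of i "Suc i"] this[of "Suc i" i] show ?thesis
    by (cases "even i") (auto simp: abs_minus_commute)
qed

lemma tour_point_gap:
  assumes mn: "m \<le> n" "3 \<le> m * n" and p: "p < m * n"
  defines "u \<equiv> tour_point m n p" and "v \<equiv> tour_point m n (Suc p mod (m * n))"
  shows "guarantee m n \<le> (fst u - fst v)\<^sup>2 + (snd u - snd v)\<^sup>2"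
proof -
  define k t where "k = int (n div 2)" and "t = int (m div 2)"
  have n: "2 \<le> n"
  proof (rule ccontr)
    assume "\<not> 2 \<le> n"
    then have "m \<le> 1" "n \<le> 1" using mn by auto
    then have "m * n \<le> 1 * 1" by (rule mult_le_mono)
    then show False using mn by simp
  qed
  then have tk: "0 \<le> t" "t \<le> k" "1 \<le> k"
    using mn by (auto simp: t_def k_def div_le_mono)
  define i j where "i = p mod n" and "j = p div n"
  have ij: "i < n" "j < m"
    using n p by (auto simp: i_def j_def less_mult_imp_div_less)
  have p_eq: "p = j * n + i" by (simp add: i_def j_def)
  have u: "u = (int (column n i) + 1, int (row m i j) + 1)"
    by (simp add: u_def tour_point_def i_def j_def)
  show ?thesis
  proof (cases "Suc i < n")
    case True
    have "Suc p < m * n"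
    proof -
      have "Suc p < Suc j * n" using True p_eq by simp
      also have "\<dots> \<le> m * n" using ij by (intro mult_le_mono1) simp
      finally show ?thesis .
    qed
    moreover have "Suc p mod n = Suc i" "Suc p div n = j"
      using True by (simp_all add: i_def j_def mod_Suc div_Suc)
    ultimately have v: "v = (int (column n (Suc i)) + 1, int (row m (Suc i) j) + 1)"
      by (simp add: v_def tour_point_def)
    have dy: "t\<^sup>2 \<le> (snd u - snd v)\<^sup>2"
      using row_gap[OF ij(2), of i] tk by (intro square_mono_abs) (simp_all add: u v t_def)
    show ?thesis
    proof (cases "even n")
      case True
      have "(k - 1)\<^sup>2 \<le> (fst u - fst v)\<^sup>2"
        using zigzag_gap[OF \<open>Suc i < n\<close>] True tk
        by (intro square_mono_abs) (auto simp: u v k_def column_def elim!: evenE)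
      with dy True show ?thesis by (simp add: guarantee_def k_def t_def)
    next
      case False
      \<comment> \<open>Because of the shift, the closing step of the zigzag cycle lies inside the
        round, so the cyclic gap is used.\<close>
      have "Suc i mod n < n" "Suc (Suc i) mod n = Suc (Suc i mod n) mod n"
        using n by (auto simp: mod_Suc_eq)
      then have "k\<^sup>2 \<le> (fst u - fst v)\<^sup>2"
        using zigzag_gap_cyclic(2)[of "Suc i mod n" n] False tk
        by (intro square_mono_abs) (auto simp: u v k_def column_def)
      with dy False show ?thesis by (simp add: guarantee_def k_def t_def)
    qed
  next
    case False
    then have i: "Suc i = n" using ij by simp
    have Sp: "Suc p = Suc j * n" using i p_eq by simp
    \<comment> \<open>The end of a round leads to the start of the next one, and from the last round
      back to round \<open>0\<close>.\<close>
    have "Suc p mod (m * n) = (Suc j mod m) * n"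
      by (metis Sp mod_mult_mult2)
    then have v: "v = (int (column n 0) + 1, int (row m 0 (Suc j mod m)) + 1)"
      using n by (simp add: v_def tour_point_def)
    show ?thesis
    proof (cases "even n")
      case True
      have i': "i = n - 1" using i by simp
      have dx: "fst u - fst v = 2 * k - 1"
        using True n by (auto simp: u v i' column_def zigzag_def k_def elim!: evenE)
      have "(k - 1)\<^sup>2 + t\<^sup>2 + 2 * (k * (k - 1)) + (k\<^sup>2 - t\<^sup>2) = (fst u - fst v)\<^sup>2"
        unfolding dx by (simp add: power2_eq_square algebra_simps)
      moreover have "t\<^sup>2 \<le> k\<^sup>2" "0 \<le> k * (k - 1)"
        using tk by (auto intro: power_mono)
      ultimately have "(k - 1)\<^sup>2 + t\<^sup>2 \<le> (fst u - fst v)\<^sup>2 + (snd u - snd v)\<^sup>2"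
        using zero_le_power2[of "snd u - snd v"] by linarith
      with True show ?thesis by (simp add: guarantee_def k_def t_def)
    next
      case False
      then have n3: "3 \<le> n" using n by presburger
      have "fst u - fst v = - (k + 1)"
        using False i n3 by (auto simp: u v column_def zigzag_def k_def elim!: oddE)
      then have dx: "(fst u - fst v)\<^sup>2 = (k + 1)\<^sup>2" by (simp only: power2_minus)
      have "even i" using i False by auto
      then have gap: "t - 1 \<le> \<bar>snd u - snd v\<bar>"
        using zigzag_gap_cyclic(1)[OF ij(2)] by (simp add: u v row_def t_def)
      \<comment> \<open>This is \<open>(t - 1)^2 - 1\<close>, weakened to include
        \<open>t = 0\<close>, where \<open>gap\<close> says nothing. Added to
        \<open>(k + 1)^2\<close> it still suffices, as \<open>t \<le> k\<close>.\<close>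
      have "t\<^sup>2 - 2 * t \<le> (snd u - snd v)\<^sup>2"
      proof (cases "t = 0")
        case False
        then have "(t - 1)\<^sup>2 \<le> (snd u - snd v)\<^sup>2"
          using gap tk by (intro square_mono_abs) auto
        then show ?thesis by (simp add: power2_eq_square algebra_simps)
      qed simp
      then have "k\<^sup>2 + t\<^sup>2 \<le> (fst u - fst v)\<^sup>2 + (snd u - snd v)\<^sup>2"
        unfolding dx using tk by (simp add: power2_eq_square algebra_simps)
      with False show ?thesis by (simp add: guarantee_def k_def t_def)
    qed
  qed
qed

lemma val_scatter_tour:
  assumes "m \<le> n" "3 \<le> m * n"
  shows "sqrt (real_of_int (guarantee m n)) \<le> val (scatter_tour m n)"
proof (rule le_valI)
  show "scatter_tour m n \<noteq> []" using assms by (cases m; cases n) (auto simp: scatter_tour_def)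
  fix p assume "p < length (scatter_tour m n)"
  then have p: "p < m * n" by (simp add: scatter_tour_def)
  then have "Suc p mod (m * n) < m * n" by (intro mod_less_divisor) linarith
  then have "scatter_tour m n ! p = tour_point m n p"
    "scatter_tour m n ! (Suc p mod length (scatter_tour m n)) = tour_point m n (Suc p mod (m * n))"
    using p by (simp_all add: scatter_tour_def)
  then show "sqrt (real_of_int (guarantee m n)) \<le> edge_length (scatter_tour m n ! p)
      (scatter_tour m n ! (Suc p mod length (scatter_tour m n)))"
    unfolding edge_length_eq using tour_point_gap[OF assms p]
    by (simp only: real_sqrt_le_iff of_int_le_iff)
qed

section \<open>The random access machine program\<close>

fun loop_free :: "com \<Rightarrow> bool" where
  "loop_free (Seq p q) \<longleftrightarrow> loop_free p \<and> loop_free q"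
| "loop_free (Cond b p q) \<longleftrightarrow> loop_free p \<and> loop_free q"
| "loop_free (While b p) \<longleftrightarrow> False"
| "loop_free _ \<longleftrightarrow> True"

text \<open>For both functions the value on loops is junk.\<close>

fun effect :: "com \<Rightarrow> memory \<times> int list \<Rightarrow> memory \<times> int list" where
  "effect Skip \<sigma> = \<sigma>"
| "effect (Store a e) \<sigma> = ((fst \<sigma>)(aval a (fst \<sigma>) := aval e (fst \<sigma>)), snd \<sigma>)"
| "effect (Write e) \<sigma> = (fst \<sigma>, snd \<sigma> @ [aval e (fst \<sigma>)])"
| "effect (Seq p q) \<sigma> = effect q (effect p \<sigma>)"
| "effect (Cond b p q) \<sigma> = (if bval b (fst \<sigma>) then effect p \<sigma> else effect q \<sigma>)"
| "effect (While b p) \<sigma> = \<sigma>"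

fun max_cost :: "com \<Rightarrow> nat" where
  "max_cost Skip = 1"
| "max_cost (Store a e) = 1 + acost a + acost e"
| "max_cost (Write e) = 1 + acost e"
| "max_cost (Seq p q) = 1 + max_cost p + max_cost q"
| "max_cost (Cond b p q) = 1 + bcost b + max (max_cost p) (max_cost q)"
| "max_cost (While b p) = 0"

lemma exec_loop_free:
  "loop_free p \<Longrightarrow> \<exists>t \<le> max_cost p. exec p \<sigma> t (effect p \<sigma>)"
proof (induction p arbitrary: \<sigma>)
  case Skip
  show ?case using exec_Skip[of "fst \<sigma>" "snd \<sigma>"] by auto
next
  case (Store a e)
  show ?case using exec_Store[of a e "fst \<sigma>" "snd \<sigma>"] by auto
next
  case (Write e)
  show ?case using exec_Write[of e "fst \<sigma>" "snd \<sigma>"] by auto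
next
  case (Seq p q)
  obtain t u where tu: "t \<le> max_cost p" "exec p \<sigma> t (effect p \<sigma>)"
    "u \<le> max_cost q" "exec q (effect p \<sigma>) u (effect q (effect p \<sigma>))"
    using Seq.IH Seq.prems by (metis loop_free.simps(1))
  then show ?case
    using exec_Seq[OF tu(2,4)] by (intro exI[of _ "1 + t + u"]) auto
next
  case (Cond b p q)
  show ?case
  proof (cases "bval b (fst \<sigma>)")
    case True
    obtain t where "t \<le> max_cost p" "exec p \<sigma> t (effect p \<sigma>)"
      using Cond.IH(1)[of \<sigma>] Cond.prems by auto
    then show ?thesis
      using True exec_CondT[OF True] by (intro exI[of _ "1 + bcost b + t"]) auto
  next
    case False
    obtain t where "t \<le> max_cost q" "exec q \<sigma> t (effect q \<sigma>)"
      using Cond.IH(2)[of \<sigma>] Cond.prems by auto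
    then show ?thesis
      using False exec_CondF[OF False] by (intro exI[of _ "1 + bcost b + t"]) auto
  qed
qed auto

text \<open>The invariant is indexed by the number of completed iterations, so it forces exactly
  \<open>N - q\<close> further ones. The induction descends from \<open>N\<close>, where the test
  fails.\<close>

lemma exec_while:
  assumes p: "loop_free p" and q: "q \<le> N"
    and step: "\<And>q \<sigma>. q < N \<Longrightarrow> I q \<sigma> \<Longrightarrow> bval b (fst \<sigma>) \<and> I (Suc q) (effect p \<sigma>)"
    and halt: "\<And>\<sigma>. I N \<sigma> \<Longrightarrow> \<not> bval b (fst \<sigma>)"
    and I: "I q \<sigma>"
  shows "\<exists>t \<sigma>'. exec (While b p) \<sigma> t \<sigma>' \<and> I N \<sigma>' \<and>
    t \<le> (N - q) * (1 + bcost b + max_cost p) + (1 + bcost b)"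
  using q I
proof (induction q arbitrary: \<sigma> rule: inc_induct)
  case base
  then show ?case
    using exec_WhileF[OF halt[of \<sigma>], of p] by (intro exI[of _ "1 + bcost b"] exI[of _ \<sigma>]) auto
next
  case (step q)
  let ?c = "1 + bcost b + max_cost p"
  have b: "bval b (fst \<sigma>)" and I: "I (Suc q) (effect p \<sigma>)"
    using assms(3) step by auto
  obtain t where t: "t \<le> max_cost p" "exec p \<sigma> t (effect p \<sigma>)"
    using exec_loop_free[OF p] by blast
  obtain u \<sigma>' where u: "exec (While b p) (effect p \<sigma>) u \<sigma>'" "I N \<sigma>'"
    "u \<le> (N - Suc q) * ?c + (1 + bcost b)"
    using step.IH[OF I] by blast
  have "N - q = Suc (N - Suc q)" using step by simp
  then have "1 + bcost b + t + u \<le> (N - q) * ?c + (1 + bcost b)"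
    using t u by simp
  with exec_WhileT[OF b t(2) u(1)] u(2) show ?case by blast
qed

section \<open>The program for the tour\<close>

abbreviation reg :: "int \<Rightarrow> aexp" where
  "reg i \<equiv> Mem (Const i)"

text \<open>The machine has no division, so the half is found by counting up, in linear time. The
  \<open>+ 1\<close> in the test makes the count stop at the half rounded down.\<close>

definition halve :: "int \<Rightarrow> int \<Rightarrow> com" where
  "halve r r' = While (Less (Add (Add (reg r) (reg r)) (Const 1)) (reg r'))
     (Store (Const r) (Add (reg r) (Const 1)))"

text \<open>A successful test costs 11 steps including the loop overhead and the store 6, giving 17
  per iteration; the failing test costs the final 11.\<close>

lemma exec_halve:
  assumes "s r = 0" "s r' = int N" "r \<noteq> r'"
  shows "\<exists>t \<le> 17 * N + 11. exec (halve r r') (s, out) t (s(r := int (N div 2)), out)"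
proof -
  let ?I = "\<lambda>q \<sigma>. \<sigma> = (s(r := int q), out)"
  let ?b = "Less (Add (Add (reg r) (reg r)) (Const 1)) (reg r')"
  let ?p = "Store (Const r) (Add (reg r) (Const 1))"
  have "\<exists>t \<sigma>'. exec (While ?b ?p) (s, out) t \<sigma>' \<and> ?I (N div 2) \<sigma>' \<and>
      t \<le> (N div 2 - 0) * (1 + bcost ?b + max_cost ?p) + (1 + bcost ?b)"
    by (rule exec_while) (use assms in \<open>auto simp: fun_upd_idem\<close>)
  then obtain t where "exec (While ?b ?p) (s, out) t (s(r := int (N div 2)), out)"
    "t \<le> (N div 2 - 0) * (1 + bcost ?b + max_cost ?p) + (1 + bcost ?b)"
    by blast
  moreover have "(N div 2 - 0) * (1 + bcost ?b + max_cost ?p) + (1 + bcost ?b) \<le> 17 * N + 11"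
    using div_le_dividend[of N 2] by (simp del: div_le_dividend)
  ultimately show ?thesis
    unfolding halve_def by (meson le_trans)
qed

text \<open>Registers: 0 and 1 hold \<open>m\<close> and \<open>n\<close>, 2 and 3 their halves, 4 the position in the round,
  5 the column, 6 the row at even positions, 7 the number of the round, 8 the parity of the
  position, 9 the first column of a round.\<close>

definition init_prog :: com where
  "init_prog = Seq
     (Cond (Less (Add (reg 2) (reg 2)) (reg 1)) (Store (Const 9) (Sub (reg 1) (reg 2))) Skip)
     (Store (Const 5) (reg 9))"

definition write_prog :: com where
  "write_prog = Seq (Write (Add (reg 5) (Const 1)))
     (Cond (Less (reg 8) (Const 1)) (Write (Add (reg 6) (Const 1)))
       (Cond (Less (reg 6) (Sub (reg 0) (reg 3)))
         (Write (Add (Add (reg 6) (reg 3)) (Const 1)))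
         (Write (Add (Sub (reg 6) (Sub (reg 0) (reg 3))) (Const 1)))))"

definition zigzag_prog :: "int \<Rightarrow> int \<Rightarrow> int \<Rightarrow> com" where
  "zigzag_prog r h l = Cond (Less (reg r) (reg h))
     (Store (Const r) (Add (reg r) (Sub (reg l) (reg h))))
     (Store (Const r) (Add (Sub (reg r) (Sub (reg l) (reg h))) (Const 1)))"

definition advance_prog :: com where
  "advance_prog = Cond (Less (Add (reg 4) (Const 1)) (reg 1))
     (Seq (Store (Const 4) (Add (reg 4) (Const 1)))
       (Seq (Store (Const 8) (Sub (Const 1) (reg 8))) (zigzag_prog 5 2 1)))
     (Seq (Store (Const 4) (Const 0)) (Seq (Store (Const 8) (Const 0))
       (Seq (Store (Const 5) (reg 9)) (Seq (Store (Const 7) (Add (reg 7) (Const 1)))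
         (zigzag_prog 6 3 0)))))"

definition tour_prog :: com where
  "tour_prog = Seq (halve 2 1) (Seq (halve 3 0) (Seq init_prog
     (While (Less (reg 7) (reg 0)) (Seq write_prog advance_prog))))"

text \<open>Register 6 is left open once \<open>p = m * n\<close>: the last advance applies the row
  recurrence beyond the final round.\<close>

definition tour_state :: "nat \<Rightarrow> nat \<Rightarrow> nat \<Rightarrow> memory \<times> int list \<Rightarrow> bool" where
  "tour_state m n p \<sigma> \<longleftrightarrow>
     fst \<sigma> 0 = int m \<and> fst \<sigma> 1 = int n \<and> fst \<sigma> 2 = int (n div 2) \<and> fst \<sigma> 3 = int (m div 2) \<and>
     fst \<sigma> 4 = int (p mod n) \<and> fst \<sigma> 5 = int (column n (p mod n)) \<and>
     (p < m * n \<longrightarrow> fst \<sigma> 6 = int (zigzag m (p div n))) \<and>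
     fst \<sigma> 7 = int (p div n) \<and> fst \<sigma> 8 = int (p mod n mod 2) \<and> fst \<sigma> 9 = int (column n 0) \<and>
     snd \<sigma> = encode_tour (map (tour_point m n) [0..<p])"

section \<open>Correctness and running time of the program\<close>

lemma effect_write:
  assumes "tour_state m n p \<sigma>" "p < m * n"
  shows "effect write_prog \<sigma> = (fst \<sigma>, encode_tour (map (tour_point m n) [0..<Suc p]))"
proof -
  have j: "p div n < m"
    using assms(2) by (simp add: less_mult_imp_div_less)
  have "encode_tour (map (tour_point m n) [0..<Suc p]) =
      snd \<sigma> @ [int (column n (p mod n)) + 1, int (row m (p mod n) (p div n)) + 1]"
    using assms by (simp add: tour_state_def encode_tour_def tour_point_def)
  moreover have "even (p mod n) \<or> odd (p mod n)" by blast
  ultimately show ?thesis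
    using assms row_odd[OF j, of "p mod n"]
    by (auto simp: write_prog_def tour_state_def row_def odd_iff_mod_2_eq_one)
qed

text \<open>The recurrence of \<open>zigzag\<close> survives the shift for odd \<open>n\<close>: at
  the wrap the column is \<open>n div 2\<close>, and the second branch yields \<open>0\<close>, the
  first zigzag value.\<close>

lemma column_Suc:
  assumes "Suc i < n"
  shows "column n (Suc i) =
    (if column n i < n div 2 then column n i + (n - n div 2) else column n i + 1 - (n - n div 2))"
proof (cases "odd n \<and> Suc (Suc i) = n")
  case True
  then have "odd i" by auto
  then obtain a where "i = 2 * a + 1" by (rule oddE)
  with True show ?thesis by (auto simp: column_def zigzag_def)
next
  case False
  then show ?thesis
    using assms zigzag_Suc[of i n] zigzag_Suc[of "Suc i" n]
    by (cases "even n") (simp_all add: column_def)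
qed

lemma effect_advance:
  assumes st: "tour_state m n p (s, out)" and p: "p < m * n"
  shows "tour_state m n (Suc p)
    (effect advance_prog (s, encode_tour (map (tour_point m n) [0..<Suc p])))"
proof (cases "Suc (p mod n) < n")
  case True
  then have "Suc p mod n = Suc (p mod n)" "Suc p div n = p div n"
    by (simp_all add: mod_Suc div_Suc)
  moreover have "int (Suc (p mod n) mod 2) = 1 - int (p mod n mod 2)"
    by (simp add: mod_Suc)
  ultimately show ?thesis
    using st p True column_Suc[OF True]
    by (auto simp: advance_prog_def zigzag_prog_def tour_state_def)
next
  case False
  have n: "0 < n" using p by (cases n) auto
  then have "Suc (p mod n) = n"
    using False mod_less_divisor[OF n, of p] by linarith
  then have Sp: "Suc p mod n = 0" "Suc p div n = Suc (p div n)"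
    by (simp_all add: mod_Suc div_Suc)
  have "Suc (p div n) < m" if "Suc p < m * n"
    using that Sp(2) by (metis less_mult_imp_div_less)
  then show ?thesis
    using st p False Sp zigzag_Suc[of "p div n" m]
    by (auto simp: advance_prog_def zigzag_prog_def tour_state_def)
qed

text \<open>The constant is \<open>59 = 17 + 17 + 11 + 11 + 3\<close>: both counting loops and three
  sequencing steps.\<close>

lemma linear_cost_bound:
  fixes m n :: nat
  assumes "t1 \<le> 17 * n + 11" "t2 \<le> 17 * m + 11" "t3 \<le> ci" "t4 \<le> m * n * cp + cb" "0 < m" "0 < n"
  shows "1 + t1 + (1 + t2 + (1 + t3 + t4)) \<le> (59 + ci + cp + cb) * (m * n)"
proof -
  have "n \<le> m * n" "m \<le> m * n" "1 \<le> m * n" "ci \<le> ci * (m * n)" "cb \<le> cb * (m * n)"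
    using assms(5,6) by auto
  moreover have "(59 + ci + cp + cb) * (m * n) =
      59 * (m * n) + ci * (m * n) + m * n * cp + cb * (m * n)"
    by (simp add: algebra_simps)
  ultimately show ?thesis
    using assms(1-4) by linarith
qed

lemma exec_tour_prog:
  "\<exists>c. \<forall>m n. 3 \<le> m * n \<longrightarrow> m \<le> n \<longrightarrow>
     computes_within tour_prog [int m, int n] (encode_tour (scatter_tour m n)) (c * (m * n))"
proof (intro exI allI impI)
  fix m n :: nat assume mn: "3 \<le> m * n" "m \<le> n"
  let ?b = "Less (reg 7) (reg 0)" and ?p = "Seq write_prog advance_prog"
  let ?ci = "max_cost init_prog" and ?cp = "1 + bcost ?b + max_cost ?p" and ?cb = "1 + bcost ?b"
  let ?s0 = "input_memory [int m, int n]"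
  let ?s1 = "?s0(2 := int (n div 2))" let ?s2 = "?s1(3 := int (m div 2))"
  have pos: "0 < m" "0 < n" using mn by (cases m; cases n; auto)+
  have n2: "2 \<le> n"
  proof (rule ccontr)
    assume "\<not> 2 \<le> n"
    then have "m * n \<le> 1 * 1" using mn by (intro mult_le_mono) auto
    then show False using mn by simp
  qed
  obtain t1 where t1: "t1 \<le> 17 * n + 11" "exec (halve 2 1) (?s0, []) t1 (?s1, [])"
    using exec_halve[of ?s0 2 1 n "[]"] by (auto simp: input_memory_def)
  obtain t2 where t2: "t2 \<le> 17 * m + 11" "exec (halve 3 0) (?s1, []) t2 (?s2, [])"
    using exec_halve[of ?s1 3 0 m "[]"] by (auto simp: input_memory_def)
  have "loop_free init_prog" by (simp add: init_prog_def)
  then obtain t3 where t3: "t3 \<le> max_cost init_prog"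
    "exec init_prog (?s2, []) t3 (effect init_prog (?s2, []))"
    using exec_loop_free by blast
  \<comment> \<open>Register 9 stays \<open>0\<close> for even \<open>n\<close> and becomes
    \<open>n - n div 2 = zigzag n 1\<close> for odd \<open>n\<close>; \<open>n2\<close> gives
    \<open>1 mod n = 1\<close>.\<close>
  have st0: "tour_state m n 0 (effect init_prog (?s2, []))"
    using n2 pos
    by (cases "even n") (auto simp: tour_state_def init_prog_def input_memory_def column_def
      zigzag_def encode_tour_def elim!: evenE oddE)
  have "\<exists>t \<sigma>. exec (While ?b ?p) (effect init_prog (?s2, [])) t \<sigma> \<and> tour_state m n (m * n) \<sigma> \<and>
      t \<le> (m * n - 0) * (1 + bcost ?b + max_cost ?p) + (1 + bcost ?b)"
  proof (rule exec_while)
    show "loop_free ?p"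
      by (simp add: write_prog_def advance_prog_def zigzag_prog_def)
    show "bval ?b (fst \<sigma>) \<and> tour_state m n (Suc q) (effect ?p \<sigma>)"
      if "q < m * n" "tour_state m n q \<sigma>" for q \<sigma>
      using that effect_write[OF that(2,1)] effect_advance[of m n q "fst \<sigma>" "snd \<sigma>"]
      by (auto simp: tour_state_def[of m n q] less_mult_imp_div_less)
    show "\<not> bval ?b (fst \<sigma>)" if "tour_state m n (m * n) \<sigma>" for \<sigma>
      using that pos by (simp add: tour_state_def)
  qed (simp, rule st0)
  then obtain t4 \<sigma> where t4: "exec (While ?b ?p) (effect init_prog (?s2, [])) t4 \<sigma>"
    "tour_state m n (m * n) \<sigma>"
    "t4 \<le> m * n * (1 + bcost ?b + max_cost ?p) + (1 + bcost ?b)"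
    by auto
  have "snd \<sigma> = encode_tour (scatter_tour m n)"
    using t4(2) by (simp add: tour_state_def scatter_tour_def)
  then have "\<sigma> = (fst \<sigma>, encode_tour (scatter_tour m n))"
    by (simp add: prod_eq_iff)
  moreover have "exec tour_prog (?s0, []) (1 + t1 + (1 + t2 + (1 + t3 + t4))) \<sigma>"
    unfolding tour_prog_def
    by (rule exec_Seq[OF t1(2) exec_Seq[OF t2(2) exec_Seq[OF t3(2) t4(1)]]])
  moreover have "1 + t1 + (1 + t2 + (1 + t3 + t4)) \<le> (59 + ?ci + ?cp + ?cb) * (m * n)"
    by (rule linear_cost_bound[OF t1(1) t2(1) t3(1) t4(3) pos])
  ultimately show "computes_within tour_prog [int m, int n] (encode_tour (scatter_tour m n))
      ((59 + ?ci + ?cp + ?cb) * (m * n))"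
    unfolding computes_within_def
    by (intro exI[of _ "1 + t1 + (1 + t2 + (1 + t3 + t4))"] exI[of _ "fst \<sigma>"] conjI)
      (assumption, erule subst)
qed

section \<open>The approximation guarantee\<close>

lemma scatter_tour_odd:
  assumes mn: "1 \<le> m" "m \<le> n" "3 \<le> m * n" and n: "odd n"
  shows "val (scatter_tour m n) = OPT m n"
proof (rule antisym)
  let ?T = "scatter_tour m n"
  have T: "tour m n ?T" using mn by (intro scatter_tour_tour) auto
  then show "val ?T \<le> OPT m n" by (rule val_le_OPT)
  have "OPT m n \<le> sqrt (real_of_int ((int (n div 2))\<^sup>2 + (int (m div 2))\<^sup>2))"
  proof (rule OPT_leI[OF T])
    fix T assume "tour m n T"
    then show "val T \<le> sqrt (real_of_int ((int (n div 2))\<^sup>2 + (int (m div 2))\<^sup>2))"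
      using n mn
      \<comment> \<open>The vertex lies in the middle column, with at most \<open>m div 2\<close>
        rows on either side for both parities of \<open>m\<close>.\<close>
      by (intro val_le_far_vertex[of m n T "int (n div 2) + 1" "int (m div 2) + 1"])
        (auto simp: grid_def elim!: oddE)
  qed
  then show "OPT m n \<le> val ?T"
    using val_scatter_tour[OF mn(2,3)] n by (simp add: guarantee_def)
qed

text \<open>\<open>B\<close> bounds the squared optimum from above and \<open>B - d\<close> is the
  squared guarantee, so the ratio is \<open>sqrt ((B - d) / B)\<close>.\<close>

lemma scatter_tour_approx:
  assumes mn: "m \<le> n" "3 \<le> m * n" "even n"
    and B: "\<And>T. tour m n T \<Longrightarrow> val T \<le> sqrt B" and B0: "0 < B"
    and d: "B - d = (real (n div 2) - 1)\<^sup>2 + (real (m div 2))\<^sup>2"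
  shows "sqrt (1 - d / B) * OPT m n \<le> val (scatter_tour m n)"
proof -
  have T: "tour m n (scatter_tour m n)" using mn by (intro scatter_tour_tour) auto
  have "0 \<le> B - d" unfolding d by simp
  then have "0 \<le> 1 - d / B" using B0 by (simp add: field_simps)
  then have "sqrt (1 - d / B) * OPT m n \<le> sqrt (1 - d / B) * sqrt B"
    using OPT_leI[OF T B] by (intro mult_left_mono) auto
  also have "\<dots> = sqrt (B - d)"
    using B0 by (simp add: real_sqrt_mult[symmetric] left_diff_distrib)
  also have "\<dots> = sqrt (real_of_int (guarantee m n))"
    using mn by (simp add: guarantee_def d)
  also have "\<dots> \<le> val (scatter_tour m n)"
    using mn by (intro val_scatter_tour) auto
  finally show ?thesis .
qed

lemma scatter_tour_even_even:
  fixes m n :: nat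
  defines "k \<equiv> real (n div 2)" and "t \<equiv> real (m div 2)"
  assumes mn: "1 \<le> m" "m \<le> n" "3 \<le> m * n" "even n" "even m"
  shows "sqrt (1 - 2 * (k - t) / ((k - t)\<^sup>2 + 2 * t * (k - 1) + 1)) * OPT m n
    \<le> val (scatter_tour m n)"
proof -
  \<comment> \<open>The denominator is the squared upper bound in disguise;
    \<open>2 * (k - t)\<close> is its excess over the squared guarantee.\<close>
  have D: "(k - t)\<^sup>2 + 2 * t * (k - 1) + 1 = k\<^sup>2 + (t - 1)\<^sup>2"
    by (simp add: power2_eq_square algebra_simps)
  have tk: "1 \<le> int (m div 2)" "int (m div 2) \<le> int (n div 2)"
    using mn by (auto simp: div_le_mono elim!: evenE)
  then have "1 \<le> k" by (simp add: k_def)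
  then have "0 < k\<^sup>2 + (t - 1)\<^sup>2" by (intro add_pos_nonneg) auto
  moreover have "val T \<le> sqrt (k\<^sup>2 + (t - 1)\<^sup>2)" if "tour m n T" for T
  proof -
    have "int n = 2 * int (n div 2)" "int m = 2 * int (m div 2)"
      using mn by (auto elim!: evenE)
    from val_le_even_even[OF that this tk] show ?thesis by (simp add: k_def t_def)
  qed
  moreover have "k\<^sup>2 + (t - 1)\<^sup>2 - 2 * (k - t) = (k - 1)\<^sup>2 + t\<^sup>2"
    by (simp add: power2_eq_square algebra_simps)
  ultimately show ?thesis
    unfolding D using mn by (intro scatter_tour_approx) (auto simp: k_def t_def)
qed

lemma scatter_tour_even_odd:
  fixes m n :: nat
  defines "k \<equiv> real (n div 2)" and "t \<equiv> real (m div 2)"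
  assumes mn: "1 \<le> m" "m \<le> n" "3 \<le> m * n" "even n" "odd m"
  shows "sqrt (1 - (2 * k - 1) / (k\<^sup>2 + t\<^sup>2)) * OPT m n \<le> val (scatter_tour m n)"
proof -
  have k: "1 \<le> n div 2" using mn by (auto elim!: evenE)
  then have "0 < k\<^sup>2 + t\<^sup>2" by (intro add_pos_nonneg) (auto simp: k_def)
  moreover have "val T \<le> sqrt (k\<^sup>2 + t\<^sup>2)" if "tour m n T" for T
    using val_le_far_vertex[OF that, of "int (n div 2)" "int (m div 2) + 1"
        "int (n div 2)" "int (m div 2)"] mn k
    by (auto simp: k_def t_def grid_def elim!: evenE oddE)
  moreover have "k\<^sup>2 + t\<^sup>2 - (2 * k - 1) = (k - 1)\<^sup>2 + t\<^sup>2"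
    by (simp add: power2_eq_square algebra_simps)
  ultimately show ?thesis
    using mn by (intro scatter_tour_approx) (auto simp: k_def t_def)
qed

lemma scatter_tour_two_rows:
  assumes n: "even n" "3 \<le> n"
  shows "val (scatter_tour 2 n) = OPT 2 n"
proof (rule antisym)
  let ?T = "scatter_tour 2 n" and ?k = "int (n div 2)"
  have T: "tour 2 n ?T" using n by (intro scatter_tour_tour) auto
  then show "val ?T \<le> OPT 2 n" by (rule val_le_OPT)
  have k: "int n = 2 * ?k" "2 \<le> ?k"
    using n by (auto elim!: evenE)
  have "OPT 2 n \<le> sqrt (real_of_int ((?k - 1)\<^sup>2 + 1))"
    using val_le_two_rows[OF _ k] by (intro OPT_leI[OF T]) auto
  then show "OPT 2 n \<le> val ?T"
    using val_scatter_tour[of 2 n] n by (simp add: guarantee_def)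
qed

lemma scatter_tour_optimal:
  assumes mn: "1 \<le> m" "m \<le> n" "3 \<le> m * n" and c: "odd n \<or> m = n \<or> m = 2"
  shows "val (scatter_tour m n) = OPT m n"
proof (cases "odd n")
  case True
  with mn show ?thesis by (rule scatter_tour_odd)
next
  case False
  show ?thesis
  proof (cases "m = n")
    case True
    \<comment> \<open>Here \<open>k = t\<close>, so the approximation ratio equals 1.\<close>
    then have "OPT m n \<le> val (scatter_tour m n)"
      using scatter_tour_even_even[OF mn] False by simp
    then show ?thesis
      using val_le_OPT[OF scatter_tour_tour[OF mn(3)]] by simp
  next
    case ne: False
    \<comment> \<open>Now \<open>n > 2\<close>; the 2 by 2 grid belongs to the square case.\<close>
    with c False have "m = 2" by blast
    with ne mn False show ?thesis by (auto intro: scatter_tour_two_rows)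
  qed
qed

theorem theorem1:
  "\<exists>(P :: com) (c :: nat). \<forall>(m :: nat) (n :: nat).
     1 \<le> m \<and> m \<le> n \<and> 3 \<le> m * n \<longrightarrow>
     (\<exists>T. computes_within P [int m, int n] (encode_tour T) (c * (m * n)) \<and> tour m n T \<and>
        (let k = real (n div 2); t = real (m div 2) in
           (odd n \<or> m = n \<or> m = 2 \<longrightarrow> val T = OPT m n) \<and>
           (even m \<and> even n \<longrightarrow>
              val T \<ge> sqrt (1 - 2 * (k - t) / ((k - t)\<^sup>2 + 2 * t * (k - 1) + 1)) * OPT m n) \<and>
           (even n \<and> odd m \<longrightarrow>
              val T \<ge> sqrt (1 - (2 * k - 1) / (k\<^sup>2 + t\<^sup>2)) * OPT m n)))"
proof -
  obtain c where c: "\<And>m n. 3 \<le> m * n \<Longrightarrow> m \<le> n \<Longrightarrow>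
      computes_within tour_prog [int m, int n] (encode_tour (scatter_tour m n)) (c * (m * n))"
    using exec_tour_prog by blast
  show ?thesis
  proof (intro exI[of _ tour_prog] exI[of _ c] allI impI, elim conjE)
    fix m n :: nat assume mn: "1 \<le> m" "m \<le> n" "3 \<le> m * n"
    show "\<exists>T. computes_within tour_prog [int m, int n] (encode_tour T) (c * (m * n)) \<and>
        tour m n T \<and>
        (let k = real (n div 2); t = real (m div 2) in
           (odd n \<or> m = n \<or> m = 2 \<longrightarrow> val T = OPT m n) \<and>
           (even m \<and> even n \<longrightarrow>
              val T \<ge> sqrt (1 - 2 * (k - t) / ((k - t)\<^sup>2 + 2 * t * (k - 1) + 1)) * OPT m n) \<and>
           (even n \<and> odd m \<longrightarrow>
              val T \<ge> sqrt (1 - (2 * k - 1) / (k\<^sup>2 + t\<^sup>2)) * OPT m n))"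
      using c[OF mn(3,2)] scatter_tour_tour[OF mn(3)] scatter_tour_optimal[OF mn]
        scatter_tour_even_even[OF mn] scatter_tour_even_odd[OF mn]
      unfolding Let_def by (intro exI[of _ "scatter_tour m n"]) blast
  qed
qed

end
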